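(* Let $\mathcal{A}$ be a supersolvable line arrangement in $\mathbf{P}^2_{\mathbb{K}}$ over a field $\mathbb{K}$ of characteristic zero, and let $p$ be a modular point of $\mathcal{A}$ with $\mu(p)\ge1$; put $m=\mu(p)+1=|\mathcal{A}_p|$. Assume $|\mathcal{A}\setminus\mathcal{A}_p|\ge1$. Then $n_2(\mathcal{A})\ge\max\{|\mathcal{A}|-m,\,m\}$.
   Context: A line arrangement $\mathcal{A}$ in $\mathbf{P}^2_{\mathbb{K}}$ is a finite set of lines; standing assumption: the lines do not all pass through one common point. $L_2(\mathcal{A})$ is the set of points that are intersections of at least two lines of $\mathcal{A}$. For $p\in L_2(\mathcal{A})$, $\mathcal{A}_p=\{H\in\mathcal{A}\mid p\in H\}$, $\mu(p)=|\mathcal{A}_p|-1$; $p$ is a double point if $\mu(p)=1$; $n_2(\mathcal{A})$ is the number of double points. $\mathcal{A}$ is supersolvable with modular point $p$ if for all distinct $H,L\in\mathcal{A}\setminus\mathcal{A}_p$ there is a unique $K\in\mathcal{A}_p$ with $H\cap L\subset K$. *)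

theory Defs
  imports "HOL-Analysis.Cartesian_Space"
begin

text \<open>
  The projective plane over a field \<open>'k\<close>: points are the one-dimensional linear subspaces of
  \<open>'k^3\<close>, and a line is the set of points contained in a fixed two-dimensional linear subspace.
  Incidence and intersection of lines are then plain membership and intersection of sets.
\<close>

definition proj_points :: "('k::field ^ 3) set set" where
  "proj_points = {p. vec.subspace p \<and> vec.dim p = 1}"

definition proj_line_of :: "('k::field ^ 3) set \<Rightarrow> ('k ^ 3) set set" where
  "proj_line_of W = {p \<in> proj_points. p \<subseteq> W}"

definition proj_lines :: "('k::field ^ 3) set set set" where
  "proj_lines = proj_line_of ` {W. vec.subspace W \<and> vec.dim W = 2}"

text \<open>The last conjunct is the standing assumption that the lines have no common point.\<close>

definition line_arrangement :: "('k::field ^ 3) set set set \<Rightarrow> bool" where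
  "line_arrangement A \<longleftrightarrow>
     finite A \<and> A \<subseteq> proj_lines \<and> \<not> (\<exists>q\<in>proj_points. \<forall>H\<in>A. q \<in> H)"

definition L2 :: "('k::field ^ 3) set set set \<Rightarrow> ('k ^ 3) set set" where
  "L2 A = {p. \<exists>H\<in>A. \<exists>L\<in>A. H \<noteq> L \<and> H \<inter> L = {p}}"

definition lines_through ::
    "('k::field ^ 3) set set set \<Rightarrow> ('k ^ 3) set \<Rightarrow> ('k ^ 3) set set set" where
  "lines_through A p = {H \<in> A. p \<in> H}"

text \<open>
  Natural-number subtraction: the value agrees with the integer \<open>|A_p| - 1\<close> as soon as \<open>p\<close> lies on
  some line of \<open>A\<close>, in particular on \<open>L2 A\<close>; otherwise it is 0.
\<close>

definition mu :: "('k::field ^ 3) set set set \<Rightarrow> ('k ^ 3) set \<Rightarrow> nat" where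
  "mu A p = card (lines_through A p) - 1"

definition double_points :: "('k::field ^ 3) set set set \<Rightarrow> ('k ^ 3) set set" where
  "double_points A = {p \<in> L2 A. mu A p = 1}"

definition n2 :: "('k::field ^ 3) set set set \<Rightarrow> nat" where
  "n2 A = card (double_points A)"

definition supersolvable_with_modular_point ::
    "('k::field ^ 3) set set set \<Rightarrow> ('k ^ 3) set \<Rightarrow> bool" where
  "supersolvable_with_modular_point A p \<longleftrightarrow>
     p \<in> proj_points \<and>
     (\<forall>H \<in> A - lines_through A p. \<forall>L \<in> A - lines_through A p.
        H \<noteq> L \<longrightarrow> (\<exists>!K. K \<in> lines_through A p \<and> H \<inter> L \<subseteq> K))"

end

(*
  Take p as the point at infinity of the vertical direction: the m lines through p become
  x = a for a in a set A, the others become graphs of affine functions f_j, any two of which agree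
  at some a in A. Every line f_z carries a double point on some x = a. Indeed, assume f_z = 0 and
  that every a in A is a root of some other f_j. Put Q = prod (x - a), u_z = Q', u_j = c_j Q / f_j
  with c_j the slope of f_j, and take the divided difference of u at the nodes f_j, multiplied by
  E = prod_{j # z} f_j. This rational function is regular and vanishes at each of the m points of A,
  but has degree exactly m - 1: its top coefficient is a nonzero multiple of m - 1, and here
  characteristic zero enters. Contradiction.

  A line off p meets the other r - 1 such lines on at most r - 1 lines through p, so it carries at
  least max (1, m - r + 1) double points, all different for different lines, and
  r * max (1, m - r + 1) is at least max (r, m).
*)
theory Submission
  imports Defs "HOL-Computational_Algebra.Computational_Algebra"
begin

section \<open>Divided differences and their integrality\<close>

text \<open>Lagrange's symmetric form puts no order on the index set. The data \<open>u\<close> are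
  indexed like the nodes, since later they are not given as a function of the node.\<close>

definition divdiff :: "('i \<Rightarrow> 'a::field) \<Rightarrow> 'i set \<Rightarrow> ('i \<Rightarrow> 'a) \<Rightarrow> 'a" where
  "divdiff x S u = (\<Sum>j\<in>S. u j / (\<Prod>k\<in>S - {j}. x j - x k))"

lemma divdiff_add: "divdiff x S (\<lambda>j. u j + v j) = divdiff x S u + divdiff x S v"
  by (simp add: divdiff_def sum.distrib add_divide_distrib)

lemma divdiff_cmult: "divdiff x S (\<lambda>j. c * u j) = c * divdiff x S u"
  by (simp add: divdiff_def sum_distrib_left)

text \<open>The new factor kills the term \<open>i\<close> and cancels the factor
  \<open>k = i\<close> in every other denominator. Both inductions below rest on this.\<close>

lemma divdiff_remove:
  assumes "finite S" "i \<in> S" "inj_on x S"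
  shows "divdiff x S (\<lambda>j. (x j - x i) * u j) = divdiff x (S - {i}) u"
proof -
  have "(x j - x i) * u j / (\<Prod>k\<in>S - {j}. x j - x k) = u j / (\<Prod>k\<in>S - {i} - {j}. x j - x k)"
    if "j \<in> S - {i}" for j
  proof -
    have "S - {j} = insert i (S - {i} - {j})" using that assms by auto
    then have "(\<Prod>k\<in>S - {j}. x j - x k) = (x j - x i) * (\<Prod>k\<in>S - {i} - {j}. x j - x k)"
      using assms by (simp add: prod.insert)
    moreover have "x j \<noteq> x i" using that assms by (auto dest: inj_onD)
    ultimately show ?thesis by simp
  qed
  then show ?thesis
    using assms by (simp add: divdiff_def sum.remove[of S i])
qed

text \<open>For \<open>i \<noteq> j\<close> the constant 1 is
  \<open>((x k - x i) - (x k - x j)) / (x j - x i)\<close>. Removing \<open>i\<close> resp.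
  \<open>j\<close> leaves two sets of equal size, whose values agree by induction and
  cancel.\<close>

lemma divdiff_one:
  assumes "finite S" "inj_on x S"
  shows "divdiff x S (\<lambda>_. 1) = (if card S = 1 then 1 else 0)"
  using assms
proof (induction "card S" arbitrary: S rule: less_induct)
  case less
  consider "S = {}" | i where "S = {i}" | i j where "i \<in> S" "j \<in> S" "i \<noteq> j"
    by blast
  then show ?case
  proof cases
    case 3
    have ne: "x j - x i \<noteq> 0" using 3 less.prems by (auto dest: inj_onD)
    have "divdiff x S (\<lambda>_. 1)
        = divdiff x S (\<lambda>k. inverse (x j - x i) * ((x k - x i) * 1) + - inverse (x j - x i) * ((x k - x j) * 1))"
    proof (intro arg_cong[where f = "divdiff x S"] ext)
      fix k
      have "inverse (x j - x i) * ((x k - x i) * 1) + - inverse (x j - x i) * ((x k - x j) * 1)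
          = inverse (x j - x i) * (x j - x i)"
        by (simp add: algebra_simps)
      then show "1 = inverse (x j - x i) * ((x k - x i) * 1) + - inverse (x j - x i) * ((x k - x j) * 1)"
        using ne by simp
    qed
    also have "\<dots> = inverse (x j - x i) * (divdiff x (S - {i}) (\<lambda>_. 1) - divdiff x (S - {j}) (\<lambda>_. 1))"
      unfolding divdiff_add divdiff_cmult
      using divdiff_remove[OF less.prems(1) 3(1) less.prems(2), of "\<lambda>_. 1"]
        divdiff_remove[OF less.prems(1) 3(2) less.prems(2), of "\<lambda>_. 1"]
      by (simp add: algebra_simps)
    also have "divdiff x (S - {i}) (\<lambda>_. 1) = divdiff x (S - {j}) (\<lambda>_. 1)"
      using less.hyps[of "S - {i}"] less.hyps[of "S - {j}"] less.prems 3
      card_gt_0_iff[of S]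
      by (auto simp: inj_on_diff card_Diff_singleton)
    moreover have "card S \<noteq> 1" using 3 by (auto simp: card_1_singleton_iff)
    ultimately show ?thesis by simp
  qed (simp_all add: divdiff_def)
qed

text \<open>Writing one factor \<open>x j\<close> as \<open>(x j - x i) + x i\<close> lowers the
  exponent without any division. It is applied with \<open>R\<close> the image of a domain in its
  fraction field.\<close>

lemma divdiff_power_in_subring:
  assumes "finite S" "inj_on x S" and x: "\<And>j. j \<in> S \<Longrightarrow> x j \<in> R"
    and R: "0 \<in> R" "1 \<in> R" "\<And>a b. a \<in> R \<Longrightarrow> b \<in> R \<Longrightarrow> a + b \<in> R" "\<And>a b. a \<in> R \<Longrightarrow> b \<in> R \<Longrightarrow> a * b \<in> R"
  shows "divdiff x S (\<lambda>j. x j ^ n) \<in> R"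
  using assms(1-3)
proof (induction n arbitrary: S)
  case 0
  then show ?case using divdiff_one[of S x] R by simp
next
  case (Suc n)
  show ?case
  proof (cases "S = {}")
    case True
    then show ?thesis using R by (simp add: divdiff_def)
  next
    case False
    then obtain i where i: "i \<in> S" by blast
    have "divdiff x S (\<lambda>j. x j ^ Suc n)
        = divdiff x S (\<lambda>j. (x j - x i) * x j ^ n + x i * x j ^ n)"
      by (intro arg_cong[where f = "divdiff x S"] ext) (simp add: algebra_simps)
    also have "\<dots> = divdiff x (S - {i}) (\<lambda>j. x j ^ n) + x i * divdiff x S (\<lambda>j. x j ^ n)"
      by (simp only: divdiff_add divdiff_cmult divdiff_remove[OF Suc.prems(1) i Suc.prems(2)])
    also have "\<dots> \<in> R"
      using Suc.prems i by (intro R(3,4) Suc.IH) (auto intro: inj_on_diff)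
    finally show ?thesis .
  qed
qed

text \<open>Integrality of divided differences, with the denominators cleared.\<close>

lemma prod_diff_dvd_sum:
  fixes y :: "'i \<Rightarrow> 'a::idom" and P :: "'a poly"
  assumes "finite S" "inj_on y S"
  defines "\<Delta> \<equiv> \<lambda>j. \<Prod>k\<in>S - {j}. y j - y k"
  shows "(\<Prod>j\<in>S. \<Delta> j) dvd (\<Sum>j\<in>S. poly P (y j) * (\<Prod>l\<in>S - {j}. \<Delta> l))"
proof -
  have D0: "\<Delta> j \<noteq> 0" if "j \<in> S" for j
    using assms that by (auto simp: \<Delta>_def dest: inj_onD)
  have fract_prod: "to_fract (prod g T) = (\<Prod>t\<in>T. to_fract (g t))" for g :: "'i \<Rightarrow> 'a" and T
    by (induction T rule: infinite_finite_induct) auto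
  have fract_sum: "to_fract (sum g T) = (\<Sum>t\<in>T. to_fract (g t))" for g :: "'i \<Rightarrow> 'a" and T
    by (induction T rule: infinite_finite_induct) auto
  \<comment> \<open>For a monomial, the quotient of the two sides is a divided difference in the
    fraction field, and that lies in the domain. A general \<open>P\<close> is a linear combination
    of monomials.\<close>
  have power: "(\<Prod>j\<in>S. \<Delta> j) dvd (\<Sum>j\<in>S. y j ^ n * (\<Prod>l\<in>S - {j}. \<Delta> l))" for n
  proof -
    let ?x = "\<lambda>j. to_fract (y j)"
    have "divdiff ?x S (\<lambda>j. ?x j ^ n) \<in> range to_fract"
    proof (rule divdiff_power_in_subring)
      show "0 \<in> range (to_fract :: 'a \<Rightarrow> _)" "1 \<in> range (to_fract :: 'a \<Rightarrow> _)"
        by (metis rangeI to_fract_0, metis rangeI to_fract_1)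
      show "a + b \<in> range to_fract" "a * b \<in> range to_fract"
        if "a \<in> range to_fract" "b \<in> range to_fract" for a b :: "'a fract"
        using that by (auto simp flip: to_fract_add to_fract_mult)
    qed (use assms in \<open>auto simp: inj_on_def\<close>)
    then obtain r where r: "divdiff ?x S (\<lambda>j. ?x j ^ n) = to_fract r" by blast
    have "to_fract (\<Sum>j\<in>S. y j ^ n * (\<Prod>l\<in>S - {j}. \<Delta> l))
        = to_fract (\<Prod>j\<in>S. \<Delta> j) * divdiff ?x S (\<lambda>j. ?x j ^ n)"
      unfolding divdiff_def fract_sum sum_distrib_left
    proof (rule sum.cong)
      fix j assume j: "j \<in> S"
      have pw: "to_fract (y j ^ n) = ?x j ^ n" by (induction n) auto
      have "(\<Prod>k\<in>S - {j}. ?x j - ?x k) = to_fract (\<Delta> j)"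
        by (simp add: \<Delta>_def fract_prod)
      moreover have "(\<Prod>j\<in>S. \<Delta> j) = \<Delta> j * (\<Prod>l\<in>S - {j}. \<Delta> l)"
        using assms(1) j by (rule prod.remove)
      ultimately show "to_fract (y j ^ n * (\<Prod>l\<in>S - {j}. \<Delta> l))
          = to_fract (\<Prod>j\<in>S. \<Delta> j) * (?x j ^ n / (\<Prod>k\<in>S - {j}. ?x j - ?x k))"
        using D0[OF j] pw by simp
    qed simp
    then have "(\<Sum>j\<in>S. y j ^ n * (\<Prod>l\<in>S - {j}. \<Delta> l)) = (\<Prod>j\<in>S. \<Delta> j) * r"
      unfolding r to_fract_mult[symmetric] to_fract_eq_iff .
    then show ?thesis by simp
  qed
  have "(\<Sum>j\<in>S. poly P (y j) * (\<Prod>l\<in>S - {j}. \<Delta> l))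
      = (\<Sum>i\<le>degree P. coeff P i * (\<Sum>j\<in>S. y j ^ i * (\<Prod>l\<in>S - {j}. \<Delta> l)))"
    unfolding poly_altdef sum_distrib_left sum_distrib_right
    by (subst sum.swap) (simp add: mult.assoc)
  also have "(\<Prod>j\<in>S. \<Delta> j) dvd \<dots>"
    by (intro dvd_sum dvd_mult power)
  finally show ?thesis .
qed

section \<open>Interpolation to high order, and polynomials with all roots in a given set\<close>

text \<open>Chinese remaindering, one point at a time. \<open>Y\<close> vanishes at the new point
  \<open>w\<close> and is 1 modulo \<open>R\<close>; its power \<open>Y ^ N\<close> vanishes to
  order \<open>N\<close> at \<open>w\<close> and is still 1 modulo \<open>R\<close>, so it switches
  between the old \<open>V\<close> and \<open>h w\<close>.\<close>

lemma poly_crt_powers: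
  fixes h :: "'k::field \<Rightarrow> 'k poly"
  assumes "finite B"
  shows "\<exists>V. \<forall>v\<in>B. [:-v, 1:] ^ N dvd V - h v"
  using assms
proof induction
  case empty
  show ?case by simp
next
  case (insert w B)
  then obtain V where V: "\<And>v. v \<in> B \<Longrightarrow> [:-v, 1:] ^ N dvd V - h v" by blast
  define R where "R = (\<Prod>v\<in>B. [:-v, 1:] ^ N)"
  have Rw: "poly R w \<noteq> 0"
    using insert by (auto simp: R_def poly_prod)
  define Y where "Y = 1 - smult (inverse (poly R w)) R"
  have "[:-w, 1:] dvd Y"
    using Rw by (simp add: Y_def poly_eq_0_iff_dvd[symmetric])
  then have 1: "[:-w, 1:] ^ N dvd Y ^ N" by (rule dvd_power_same)
  have "R dvd 1 - Y" by (simp add: Y_def dvd_smult)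
  moreover have "1 - Y dvd 1 - Y ^ N"
    by (metis dvd_triv_left one_diff_power_eq)
  ultimately have 2: "R dvd 1 - Y ^ N" using dvd_trans by blast
  let ?V = "V + (1 - Y ^ N) * (h w - V)"
  have "[:-v, 1:] ^ N dvd ?V - h v" if "v \<in> insert w B" for v
  proof (cases "v = w")
    case True
    have "?V - h w = Y ^ N * (V - h w)" by (simp add: algebra_simps)
    then show ?thesis using 1 True by (metis dvd_mult2)
  next
    case False
    then have v: "v \<in> B" using that by simp
    have "[:-v, 1:] ^ N dvd R"
      unfolding R_def using insert.hyps(1) v by (rule dvd_prodI)
    then have "[:-v, 1:] ^ N dvd (1 - Y ^ N) * (h w - V)"
      using 2 by (meson dvd_mult2 dvd_trans)
    moreover have "?V - h v = (V - h v) + (1 - Y ^ N) * (h w - V)" by simp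
    ultimately show ?thesis using V[OF v] by (metis dvd_add)
  qed
  then show ?case by blast
qed

text \<open>For finite \<open>A\<close> this means a product of linear factors with roots in
  \<open>A\<close>. It is put as a root count because the final contradiction sums orders over
  \<open>A\<close> and compares with a degree.\<close>

definition splits_over :: "'k::field set \<Rightarrow> 'k poly \<Rightarrow> bool" where
  "splits_over A p \<longleftrightarrow> p \<noteq> 0 \<and> (\<Sum>a\<in>A. order a p) = degree p"

lemma splits_over_prod:
  assumes "\<And>i. i \<in> I \<Longrightarrow> splits_over A (p i)"
  shows "splits_over A (\<Prod>i\<in>I. p i)"
  using assms
proof (induction I rule: infinite_finite_induct)
  case (insert i I)
  then show ?case
    by (auto simp: splits_over_def order_mult sum.distrib degree_mult_eq)
qed (auto simp: splits_over_def)

lemma splits_over_linear: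
  assumes "finite A" "a \<in> A" "degree p = 1" "poly p a = 0"
  shows "splits_over A p"
proof -
  have p0: "p \<noteq> 0" using assms by auto
  obtain c where c: "p = [:-a, 1:] * c" using assms(4) by (metis dvdE poly_eq_0_iff_dvd)
  with p0 have "c \<noteq> 0" by auto
  moreover from this have "degree c = 0"
    using assms(3) c degree_mult_eq[of "[:-a, 1:]" c] by (simp del: mult_pCons_left)
  ultimately obtain e where "c = [:e:]" "e \<noteq> 0" by (metis degree_eq_zeroE pCons_0_0)
  then have p: "p = smult e [:-a, 1:]" using c by simp
  have "order b [:-a, 1:] = (if b = a then 1 else 0)" for b
    using order_power_n_n[of a 1] by (auto intro!: order_0I)
  then have "order b p = (if b = a then 1 else 0)" for b
    using \<open>e \<noteq> 0\<close> by (simp add: p order_smult del: smult_pCons)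
  then show ?thesis using p0 assms by (simp add: splits_over_def)
qed

lemma sum_order_le_degree:
  assumes "finite A" "p \<noteq> 0"
  shows "(\<Sum>a\<in>A. order a p) \<le> degree p"
proof -
  have "(\<Sum>a\<in>A. order a p) = (\<Sum>a\<in>A. count (proots p) a)" by (simp add: assms)
  also have "\<dots> = (\<Sum>a\<in>A \<inter> set_mset (proots p). count (proots p) a)"
    using assms(1) by (intro sum.mono_neutral_right) (auto simp: not_in_iff)
  also have "\<dots> \<le> (\<Sum>a\<in>set_mset (proots p). count (proots p) a)"
    by (intro sum_mono2) auto
  also have "\<dots> = size (proots p)" by (simp add: size_multiset_overloaded_eq)
  also have "\<dots> \<le> degree p" by (rule size_proots_le)
  finally show ?thesis .
qed

lemma pcompose_power: "pcompose (p ^ n) r = pcompose p r ^ n"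
  by (induction n) (auto simp: pcompose_1 pcompose_mult)

lemma degree_prod_const:
  fixes p :: "'i \<Rightarrow> 'a::idom poly"
  assumes "\<And>i. i \<in> I \<Longrightarrow> p i \<noteq> 0" "\<And>i. i \<in> I \<Longrightarrow> degree (p i) = n"
  shows "degree (\<Prod>i\<in>I. p i) = card I * n"
  using assms by (subst degree_prod_eq_sum_degree) auto

section \<open>Affine forms that meet pairwise over a finite set\<close>

text \<open>To stay among polynomials, \<open>E\<close> times the divided difference of
  \<open>u\<close> at the nodes \<open>f j\<close> is multiplied by \<open>D\<close>, which gives
  \<open>N\<close>. Being regular and zero at \<open>a\<close> then reads
  \<open>order a D < order a N\<close>. As any two forms meet over \<open>A\<close>,
  \<open>D\<close> splits over \<open>A\<close>; summing over \<open>A\<close> forces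
  \<open>degree N \<ge> degree D + m\<close>, one more than possible.\<close>

lemma affine_forms_avoid_zero:
  fixes c d :: "'i \<Rightarrow> 'k::field_char_0"
  assumes fin: "finite I" "finite A" and A2: "card A \<ge> 2"
    and z: "z \<in> I" "c z = 0" "d z = 0" and inj: "inj_on c I"
    and meet: "\<And>i j. i \<in> I \<Longrightarrow> j \<in> I \<Longrightarrow> i \<noteq> j \<Longrightarrow> \<exists>a\<in>A. c i * a + d i = c j * a + d j"
  shows "\<exists>a\<in>A. \<forall>i\<in>I - {z}. c i * a + d i \<noteq> 0"
proof (rule ccontr)
  assume "\<not> ?thesis"
  then have zero: "\<exists>i\<in>I - {z}. c i * a + d i = 0" if "a \<in> A" for a
    using that by blast
  define n where "n = card I - 1"
  define m where "m = card A"
  define f where "f = (\<lambda>j. [:d j, c j:])"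
  define Q where "Q = (\<Prod>a\<in>A. [:-a, 1:])"
  define q where "q = (\<lambda>a. \<Prod>b\<in>A - {a}. [:-b, 1:])"
  \<comment> \<open>A form \<open>f j\<close> with \<open>j \<noteq> z\<close> meets
    \<open>f z = 0\<close> over its root \<open>- d j / c j\<close>, which is therefore in
    \<open>A\<close>; so \<open>c j * Q / f j\<close> is \<open>Q\<close> without that linear
    factor. At \<open>z\<close> this quotient would be 0/0, and \<open>pderiv Q\<close> takes its
    place because it agrees with \<open>q a\<close> at each \<open>a\<close> in
    \<open>A\<close>.\<close>
  define u where "u = (\<lambda>j. if j = z then pderiv Q else q (- d j / c j))"
  define \<Delta> where "\<Delta> = (\<lambda>j. \<Prod>k\<in>I - {j}. f j - f k)"
  define W where "W = (\<lambda>j. \<Prod>l\<in>I - {j}. \<Delta> l)"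
  define D where "D = (\<Prod>j\<in>I. \<Delta> j)"
  define E where "E = (\<Prod>k\<in>I - {z}. f k)"
  define N where "N = (\<Sum>j\<in>I. E * u j * W j)"
  define \<gamma> where "\<gamma> = (\<lambda>j. \<Prod>k\<in>I - {j}. c j - c k)"
  have fz: "f z = 0" by (simp add: f_def z)
  have cne: "c i \<noteq> c j" if "i \<in> I" "j \<in> I" "i \<noteq> j" for i j
    using inj that by (auto dest: inj_onD)
  have c0: "c j \<noteq> 0" if "j \<in> I - {z}" for j using cne[of j z] that z by auto
  have lin: "f i - f j \<noteq> 0" "degree (f i - f j) = 1" "lead_coeff (f i - f j) = c i - c j"
      "splits_over A (f i - f j)"
    if ij: "i \<in> I" "j \<in> I" "i \<noteq> j" for i j
  proof -
    have 1: "f i - f j = [:d i - d j, c i - c j:]" by (simp add: f_def)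
    then show "f i - f j \<noteq> 0" "degree (f i - f j) = 1" "lead_coeff (f i - f j) = c i - c j"
      using cne[OF ij] by auto
    obtain a where "a \<in> A" "c i * a + d i = c j * a + d j" using meet[OF ij] by blast
    then show "splits_over A (f i - f j)"
      using fin cne[OF ij] by (intro splits_over_linear[of A a]) (auto simp: 1 algebra_simps)
  qed
  have inj_f: "inj_on f I" using lin(1) by (force simp: inj_on_def)
  have root: "- d j / c j \<in> A" if j: "j \<in> I - {z}" for j
  proof -
    obtain a where "a \<in> A" "c j * a + d j = 0" using meet[of j z] z j by auto
    moreover from this have "a = - d j / c j" using c0[OF j] by (simp add: field_simps eq_neg_iff_add_eq_0)
    ultimately show ?thesis by simp
  qed
  have Q_q: "Q = [:-a, 1:] * q a" if "a \<in> A" for a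
    unfolding Q_def q_def using fin(2) that by (rule prod.remove)
  have degQ: "degree Q = m" "lead_coeff Q = 1"
    unfolding Q_def m_def lead_coeff_prod by (simp_all add: degree_prod_const[where n = 1])
  have degq: "degree (q a) = m - 1" "lead_coeff (q a) = 1" if "a \<in> A" for a
    using fin that unfolding q_def m_def lead_coeff_prod
    by (simp_all add: degree_prod_const[where n = 1])
  have m2: "m \<ge> 2" using A2 by (simp add: m_def)
  \<comment> \<open>In characteristic zero the derivative of the monic \<open>Q\<close> has exact
    degree \<open>m - 1\<close>, with leading coefficient \<open>m\<close> instead of the 1 of the
    other \<open>u j\<close>.\<close>
  have degu: "degree (u j) = m - 1" "lead_coeff (u j) = (if j = z then of_nat m else 1)"
    if "j \<in> I" for j
    using that degq[OF root[of j]] degQ m2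
    by (auto simp: u_def degree_pderiv coeff_pderiv Suc_diff_1)
  have u0: "u j \<noteq> 0" if "j \<in> I" for j
    using degu[OF that] m2 by (auto split: if_splits)
  have card: "card (I - {j}) = n" if "j \<in> I" for j using that fin by (simp add: n_def)
  have deg\<Delta>: "\<Delta> j \<noteq> 0" "degree (\<Delta> j) = n" "lead_coeff (\<Delta> j) = \<gamma> j" if "j \<in> I" for j
  proof -
    show "\<Delta> j \<noteq> 0" using lin(1) that fin by (auto simp: \<Delta>_def)
    show "degree (\<Delta> j) = n"
      unfolding \<Delta>_def using lin that card[OF that] by (subst degree_prod_const[where n = 1]) auto
    show "lead_coeff (\<Delta> j) = \<gamma> j"
      unfolding \<Delta>_def \<gamma>_def lead_coeff_prod using lin(3) that by (intro prod.cong) auto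
  qed
  have degW: "W j \<noteq> 0" "degree (W j) = n * n" "lead_coeff (W j) = (\<Prod>l\<in>I - {j}. \<gamma> l)" if "j \<in> I" for j
  proof -
    show "W j \<noteq> 0" using deg\<Delta>(1) fin by (auto simp: W_def)
    show "degree (W j) = n * n"
      unfolding W_def using deg\<Delta> card[OF that] by (subst degree_prod_const[where n = n]) auto
    show "lead_coeff (W j) = (\<Prod>l\<in>I - {j}. \<gamma> l)"
      unfolding W_def lead_coeff_prod using deg\<Delta>(3) by (intro prod.cong) auto
  qed
  have D_W: "D = \<Delta> j * W j" if "j \<in> I" for j
    unfolding D_def W_def using fin(1) that by (rule prod.remove)
  have f0: "f j \<noteq> 0" "degree (f j) = 1" "lead_coeff (f j) = c j" if "j \<in> I - {z}" for j
    using c0[OF that] by (auto simp: f_def)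
  have degE: "E \<noteq> 0" "degree E = n" "lead_coeff E = (\<Prod>k\<in>I - {z}. c k)"
  proof -
    show "E \<noteq> 0" using f0(1) fin by (auto simp: E_def)
    show "degree E = n"
      unfolding E_def using f0 card[OF z(1)] by (subst degree_prod_const[where n = 1]) auto
    show "lead_coeff E = (\<Prod>k\<in>I - {z}. c k)"
      unfolding E_def lead_coeff_prod using f0(3) by (intro prod.cong) auto
  qed
  have D: "splits_over A D"
    unfolding D_def \<Delta>_def by (intro splits_over_prod lin(4)) auto
  have D0: "D \<noteq> 0" using D by (simp add: splits_over_def)
  have degD: "degree D = n + n * n"
    using D_W[OF z(1)] degW[OF z(1)] deg\<Delta>[OF z(1)] by (simp add: degree_mult_eq)

  \<comment> \<open>The terms of \<open>N\<close> share the degree; were all leading coefficients of the \<open>u j\<close> equal to 1, the sum of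
    the leading terms would be a divided difference of 1, hence 0. Only \<open>u z\<close> deviates, by \<open>m - 1\<close>.\<close>
  have coeffN: "coeff N (degree D + (m - 1)) \<noteq> 0"
  proof -
    define l :: "'i \<Rightarrow> 'k" where "l = (\<lambda>j. if j = z then of_nat m else 1)"
    have \<gamma>0: "\<gamma> j \<noteq> 0" if "j \<in> I" for j
      using fin cne that by (auto simp: \<gamma>_def)
    \<comment> \<open>\<open>G\<close> is the factor common to all top coefficients; what remains of
      them is the divided difference of \<open>l\<close> at the slopes.\<close>
    define G where "G = (\<Prod>k\<in>I - {z}. c k) * (\<Prod>j\<in>I. \<gamma> j)"
    have G0: "G \<noteq> 0" using \<gamma>0 c0 fin by (auto simp: G_def)
    have "coeff (E * u j * W j) (degree D + (m - 1)) = G * (l j / \<gamma> j)" if j: "j \<in> I" for j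
    proof -
      have "degree (E * u j * W j) = degree D + (m - 1)"
        using degE degu(1)[OF j] u0[OF j] degW[OF j] degD by (simp add: degree_mult_eq)
      then have "coeff (E * u j * W j) (degree D + (m - 1)) = lead_coeff (E * u j * W j)" by simp
      also have "\<dots> = (\<Prod>k\<in>I - {z}. c k) * l j * (\<Prod>l\<in>I - {j}. \<gamma> l)"
        unfolding lead_coeff_mult degE(3) degu(2)[OF j] degW(3)[OF j] l_def ..
      also have "\<dots> = G * (l j / \<gamma> j)"
        using \<gamma>0[OF j] prod.remove[OF fin(1) j, of \<gamma>] by (simp add: G_def)
      finally show ?thesis .
    qed
    then have "coeff N (degree D + (m - 1)) = G * divdiff c I l"
      by (simp add: N_def coeff_sum divdiff_def \<gamma>_def sum_distrib_left)
    also have "divdiff c I l = divdiff c I (\<lambda>_. 1) + divdiff c I (\<lambda>j. if j = z then of_nat m - 1 else 0)"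
      unfolding divdiff_add[symmetric] by (simp add: divdiff_def l_def if_distrib cong: if_cong)
    \<comment> \<open>A single node would give 1; the second one comes from the contradiction
      hypothesis at any point of \<open>A\<close>.\<close>
    also have "divdiff c I (\<lambda>_. 1) = 0"
    proof -
      obtain a where "a \<in> A" using A2 by fastforce
      then obtain j where "j \<in> I - {z}" using zero by blast
      then have "card I \<noteq> 1" using z(1) by (auto simp: card_1_singleton_iff)
      then show ?thesis using divdiff_one[OF fin(1) inj] by simp
    qed
    also have "divdiff c I (\<lambda>j. if j = z then of_nat m - 1 else 0) = (of_nat m - 1) / \<gamma> z"
      unfolding divdiff_def using fin(1) z(1)
      by (simp add: sum.remove[of I z] \<gamma>_def)
    finally have "coeff N (degree D + (m - 1)) = G * ((of_nat m - 1) / \<gamma> z)" by simp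
    moreover have "of_nat m \<noteq> (1::'k)" using m2 by (metis of_nat_1 of_nat_eq_iff one_le_numeral numeral_le_one_iff semiring_norm(69))
    ultimately show ?thesis using G0 \<gamma>0[OF z(1)] by simp
  qed
  have N0: "N \<noteq> 0" using coeffN by auto

  \<comment> \<open>Near \<open>a\<close>, \<open>u\<close> agrees with \<open>q a\<close> times a polynomial in the nodes \<open>f j\<close>: take \<open>V\<close> constant to high
    order at every value \<open>f j (a)\<close>, so that \<open>(f j - V (f j)) / f j\<close> approximates
    \<open>(f j - f j (a)) / f j = u j / q a\<close>. Integrality of divided differences then controls \<open>N\<close>.\<close>
  have ord: "Suc (order a D) \<le> order a N" if a: "a \<in> A" for a
  proof -
    define M where "M = order a D"
    define t where "t = [:-a, 1:]"
    have tD: "t ^ M dvd D" unfolding t_def M_def by (rule order_1)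
    \<comment> \<open>A form other than \<open>f z\<close> vanishes at \<open>a\<close>, hence so
      does \<open>E\<close>: this is the one order by which \<open>N\<close> beats \<open>D\<close>
      in the main term.\<close>
    obtain k where "k \<in> I - {z}" "c k * a + d k = 0" using zero[OF a] by blast
    then have "t dvd E"
      unfolding E_def t_def using fin
      by (intro dvd_trans[OF _ dvd_prodI[of "I - {z}" k f]]) (auto simp: f_def poly_eq_0_iff_dvd[symmetric] algebra_simps)
    \<comment> \<open>The target order is \<open>M + 1\<close>; one more is asked for because
      dividing by \<open>f j\<close> in \<open>err\<close> may lose one. The value 0 occurs among
      the \<open>v\<close>, namely at \<open>z\<close>, so \<open>V\<close> is divisible by the
      variable and \<open>V1\<close> exists.\<close>
    obtain V where V: "\<And>v. v \<in> (\<lambda>j. poly (f j) a) ` I \<Longrightarrow> [:-v, 1:] ^ Suc (Suc M) dvd V - [:v:]"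
      using poly_crt_powers[of "(\<lambda>j. poly (f j) a) ` I" "Suc (Suc M)" "\<lambda>v. [:v:]"] fin by blast
    have "[:0, 1:] ^ Suc (Suc M) dvd V" using V[of 0] z(1) fz by force
    then obtain X where X: "V = [:0, 1:] ^ Suc (Suc M) * X" by blast
    define V1 where "V1 = [:0, 1:] ^ Suc M * X"
    have V1: "V = pCons 0 V1" "poly V1 0 = 0" by (simp_all add: X V1_def)
    \<comment> \<open>\<open>1 - V1\<close> is the polynomial \<open>(y - V(y)) / y\<close>; at the
      node \<open>f z = 0\<close> it takes the value 1.\<close>
    define g where "g = (\<lambda>j. pcompose (1 - V1) (f j))"
    have err: "t ^ Suc M dvd u j - q a * g j" if j: "j \<in> I - {z}" for j
    proof -
      define v where "v = poly (f j) a"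
      have fv: "f j - [:v:] = smult (c j) t" by (simp add: f_def v_def t_def)
      have "[:-v, 1:] ^ Suc (Suc M) dvd V - [:v:]" using V j by (auto simp: v_def)
      then obtain Y where "V - [:v:] = [:-v, 1:] ^ Suc (Suc M) * Y" by blast
      moreover have lin_eq: "[:-v:] + f j = f j - [:v:]" by (simp add: f_def)
      ultimately have "pcompose V (f j) - [:v:] = (f j - [:v:]) ^ Suc (Suc M) * pcompose Y (f j)"
        using pcompose_diff[of V "[:v:]" "f j"] pcompose_power[of "[:-v, 1:]" "Suc (Suc M)" "f j"]
        by (simp add: pcompose_mult pcompose_pCons lin_eq del: power_Suc)
      then have tV: "t ^ Suc (Suc M) dvd pcompose V (f j) - [:v:]"
        unfolding fv smult_power by (simp add: dvd_smult del: power_Suc)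
      have "f j = smult (c j) [:- (- d j / c j), 1:]" using c0[OF j] by (simp add: f_def)
      then have "f j * u j = smult (c j) Q"
        unfolding Q_q[OF root[OF j]] using j by (simp only: u_def mult_smult_left) simp
      also have "\<dots> = q a * (f j - [:v:])" using Q_q[OF a] by (simp add: fv t_def[symmetric] mult.commute)
      finally have fu: "f j * u j = q a * (f j - [:v:])" .
      have fg: "f j * g j = f j - pcompose V (f j)"
        by (simp add: g_def V1 pcompose_pCons pcompose_diff pcompose_1 algebra_simps)
      have "f j * (u j - q a * g j) = f j * u j - q a * (f j * g j)" by (simp add: algebra_simps)
      also have "\<dots> = q a * (pcompose V (f j) - [:v:])" unfolding fu fg by (simp add: algebra_simps)
      finally have *: "t ^ Suc (Suc M) dvd f j * (u j - q a * g j)" using tV by simp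
      show ?thesis
      proof (cases "u j - q a * g j = 0")
        case False
        then have "Suc (Suc M) \<le> order a (f j) + order a (u j - q a * g j)"
          using * f0(1)[OF j] unfolding t_def order_divides by (simp add: order_mult)
        moreover have "order a (f j) \<le> 1" using order_degree[OF f0(1)[OF j], of a] f0(2)[OF j] by simp
        ultimately show ?thesis unfolding t_def order_divides by simp
      qed simp
    qed
    have errz: "t dvd u z - q a * g z"
    proof -
      have "g z = 1" using V1(2) by (simp add: g_def fz pcompose_0' pcompose_diff poly_0_coeff_0[symmetric])
      moreover have "poly (pderiv Q) a = poly (q a) a"
        by (simp add: Q_q[OF a] pderiv_mult pderiv_pCons del: mult_pCons_left)
      ultimately show ?thesis by (simp add: u_def t_def poly_eq_0_iff_dvd[symmetric])
    qed
    \<comment> \<open>Up to sign \<open>\<Delta> z\<close> is \<open>E\<close>, so the term at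
      \<open>z\<close> already contains \<open>D\<close>, and the single factor \<open>t\<close>
      from \<open>errz\<close> suffices there.\<close>
    have "\<Delta> z dvd E" unfolding \<Delta>_def E_def by (intro prod_dvd_prod) (simp add: fz)
    then have "D dvd E * W z" using D_W[OF z(1)] by simp
    then have DE: "t ^ Suc M dvd E * (u z - q a * g z) * W z"
      using mult_dvd_mono[OF errz dvd_trans[OF tD, of "E * W z"]] by (simp add: mult_ac)
    \<comment> \<open>Integrality is used over the polynomial ring: \<open>1 - V1\<close> is read as
      a polynomial with constant coefficients and evaluated at the nodes \<open>f j\<close>.\<close>
    have "D dvd (\<Sum>j\<in>I. g j * W j)"
      using prod_diff_dvd_sum[OF fin(1) inj_f, of "map_poly (\<lambda>c. [:c:]) (1 - V1)"]
      by (simp add: g_def pcompose_altdef D_def W_def \<Delta>_def)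
    then have main: "t ^ Suc M dvd q a * (E * (\<Sum>j\<in>I. g j * W j))"
      using mult_dvd_mono[OF \<open>t dvd E\<close> dvd_trans[OF tD, of "\<Sum>j\<in>I. g j * W j"]] by simp
    have "N = q a * (E * (\<Sum>j\<in>I. g j * W j)) + (\<Sum>j\<in>I. E * (u j - q a * g j) * W j)"
      by (simp add: N_def sum_distrib_left sum.distrib[symmetric] algebra_simps)
    moreover have "t ^ Suc M dvd (\<Sum>j\<in>I. E * (u j - q a * g j) * W j)"
    proof (rule dvd_sum)
      fix j assume "j \<in> I"
      then show "t ^ Suc M dvd E * (u j - q a * g j) * W j"
        using err[of j] DE by (cases "j = z") (auto intro: dvd_mult dvd_mult2 simp del: power_Suc)
    qed
    ultimately have "t ^ Suc M dvd N" using main by simp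
    then show ?thesis using N0 by (simp add: t_def M_def order_divides del: power_Suc)
  qed

  have "degree D + m = (\<Sum>a\<in>A. Suc (order a D))"
    using D sum.distrib[of "\<lambda>a. order a D" "\<lambda>_. 1" A] by (simp add: splits_over_def m_def)
  also have "\<dots> \<le> (\<Sum>a\<in>A. order a N)" by (intro sum_mono ord)
  also have "\<dots> \<le> degree N" using fin(2) N0 by (rule sum_order_le_degree)
  also have "\<dots> \<le> degree D + (m - 1)"
    unfolding N_def
  proof (intro degree_sum_le fin(1))
    fix j assume j: "j \<in> I"
    show "degree (E * u j * W j) \<le> degree D + (m - 1)"
      using degE degu(1)[OF j] u0[OF j] degW[OF j] degD by (simp add: degree_mult_eq)
  qed
  finally show False using m2 by simp
qed

text \<open>Subtracting the form \<open>z\<close> from all forms keeps slope differences and meeting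
  points and makes the distinguished form zero.\<close>

corollary affine_forms_separated:
  fixes c d :: "'i \<Rightarrow> 'k::field_char_0"
  assumes "finite I" "finite A" "card A \<ge> 2" "z \<in> I" "inj_on c I"
    and "\<And>i j. i \<in> I \<Longrightarrow> j \<in> I \<Longrightarrow> i \<noteq> j \<Longrightarrow> \<exists>a\<in>A. c i * a + d i = c j * a + d j"
  shows "\<exists>a\<in>A. \<forall>i\<in>I - {z}. c i * a + d i \<noteq> c z * a + d z"
proof -
  have "\<exists>a\<in>A. \<forall>i\<in>I - {z}. (c i - c z) * a + (d i - d z) \<noteq> 0"
  proof (rule affine_forms_avoid_zero[OF assms(1-4)])
    show "inj_on (\<lambda>i. c i - c z) I" using assms(5) by (simp add: inj_on_def)
    show "\<exists>a\<in>A. (c i - c z) * a + (d i - d z) = (c j - c z) * a + (d j - d z)"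
      if "i \<in> I" "j \<in> I" "i \<noteq> j" for i j
      using assms(6)[OF that] by (auto simp: algebra_simps)
  qed auto
  then show ?thesis by (auto simp: algebra_simps)
qed

section \<open>Lines and planes in three-dimensional space\<close>

lemma span_eq_of_dim_1:
  fixes S :: "('k::field ^ 'n) set"
  assumes "vec.subspace S" "vec.dim S = 1" "v \<in> S" "v \<noteq> 0"
  shows "S = vec.span {v}"
proof -
  have "vec.dim (vec.span {v}) = 1"
    using assms(4) by (simp add: vec.dim_insert)
  moreover have "vec.span {v} \<subseteq> S" using assms by (simp add: vec.span_minimal)
  ultimately show ?thesis
    using vec.subspace_dim_equal[of "vec.span {v}" S] assms by (simp add: vec.subspace_span)
qed

lemma nonzero_of_dim_1:
  fixes S :: "('k::field ^ 'n) set"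
  assumes "vec.dim S = 1"
  obtains v where "v \<in> S" "v \<noteq> 0"
proof -
  have "\<not> S \<subseteq> {0}" using assms by (metis vec.dim_eq_0 zero_neq_one)
  then show thesis using that by blast
qed

lemma plane_complement:
  fixes W :: "('k::field ^ 3) set"
  assumes "vec.subspace W" "vec.dim W = 2" "e \<notin> W"
  shows "\<exists>l. u + l *s e \<in> W"
proof -
  have sp: "vec.span W = W" using assms(1) by (simp add: vec.span_eq_iff)
  have "vec.dim (insert e W) = 3" using assms(2,3) by (simp add: vec.dim_insert sp)
  then have "vec.span (insert e W) = UNIV"
    using vec.dim_eq_full[of "insert e W"] by (simp add: vec.dimension_def card_cart_basis)
  then have "u \<in> vec.span (insert e W)" by simp
  then obtain k where "u - k *s e \<in> W" using sp by (auto simp: vec.span_breakdown_eq)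
  then have "u + (- k) *s e \<in> W" by (simp add: vec.scale_minus_left)
  then show ?thesis by blast
qed

lemma subspace_shift_unique:
  fixes W :: "('k::field ^ 'n) set"
  assumes "vec.subspace W" "e \<notin> W" "u + l *s e \<in> W" "u + l' *s e \<in> W"
  shows "l = l'"
proof (rule ccontr)
  assume ne: "l \<noteq> l'"
  have "(l - l') *s e \<in> W"
    using vec.subspace_diff[OF assms(1,3,4)] by (simp add: vec.scale_left_diff_distrib)
  then have "inverse (l - l') *s ((l - l') *s e) \<in> W" by (rule vec.subspace_scale[OF assms(1)])
  then show False using ne assms(2) by simp
qed

lemma dim_plane_Int:
  fixes W1 W2 :: "('k::field ^ 3) set"
  assumes "vec.subspace W1" "vec.dim W1 = 2" "vec.subspace W2" "vec.dim W2 = 2" "W1 \<noteq> W2"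
  shows "vec.dim (W1 \<inter> W2) = 1"
proof -
  have "vec.dim {x + y |x y. x \<in> W1 \<and> y \<in> W2} + vec.dim (W1 \<inter> W2) = 4"
    using vec.dim_sums_Int[OF assms(1,3)] assms by simp
  moreover have "vec.dim {x + y |x y. x \<in> W1 \<and> y \<in> W2} \<le> 3"
    using vec.dim_subset_UNIV[of "{x + y |x y. x \<in> W1 \<and> y \<in> W2}"]
    by (simp add: vec.dimension_def card_cart_basis)
  moreover have "vec.dim (W1 \<inter> W2) < 2"
  proof (rule ccontr)
    assume "\<not> ?thesis"
    then have "W1 \<inter> W2 = W1" "W1 \<inter> W2 = W2"
      using vec.subspace_dim_equal[of "W1 \<inter> W2"] assms by (auto simp: vec.subspace_inter)
    then show False using assms(5) by blast
  qed
  ultimately show ?thesis by linarith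
qed

lemma plane_Int_singleton:
  fixes W1 W2 :: "('k::field ^ 3) set"
  assumes "vec.subspace W1" "vec.dim W1 = 2" "vec.subspace W2" "vec.dim W2 = 2" "W1 \<noteq> W2"
  shows "W1 \<inter> W2 \<in> proj_points" "proj_line_of W1 \<inter> proj_line_of W2 = {W1 \<inter> W2}"
proof -
  have sub: "vec.subspace (W1 \<inter> W2)" using assms by (simp add: vec.subspace_inter)
  have dim: "vec.dim (W1 \<inter> W2) = 1" by (rule dim_plane_Int[OF assms])
  show pt: "W1 \<inter> W2 \<in> proj_points" using sub dim by (simp add: proj_points_def)
  have "q = W1 \<inter> W2" if "q \<in> proj_points" "q \<subseteq> W1 \<inter> W2" for q
    using vec.subspace_dim_equal[of q "W1 \<inter> W2"] that sub dim by (simp add: proj_points_def)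
  moreover have "proj_line_of W1 \<inter> proj_line_of W2 = {q \<in> proj_points. q \<subseteq> W1 \<inter> W2}"
    by (auto simp only: proj_line_of_def)
  ultimately show "proj_line_of W1 \<inter> proj_line_of W2 = {W1 \<inter> W2}"
    using pt by blast
qed

section \<open>The affine chart around the modular point\<close>

text \<open>Supplies the horizontal axis \<open>W0\<close> of the chart, with direction
  \<open>b\<close> and base vector \<open>b'\<close>. Of the vectors \<open>w1 + s *s w2\<close>
  each plane in \<open>\<V>\<close> contains at most one, since two would force it to equal
  \<open>W0\<close>; an infinite field leaves an \<open>s\<close> that avoids all of them.\<close>

lemma vector_avoiding_planes:
  fixes \<V> :: "('k::field_char_0 ^ 3) set set"
  assumes "finite \<V>" "\<And>W. W \<in> \<V> \<Longrightarrow> vec.subspace W" "\<And>W. W \<in> \<V> \<Longrightarrow> vec.dim W = 2"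
    and W0: "vec.subspace W0" "vec.dim W0 = 2" "W0 \<notin> \<V>"
  shows "\<exists>b b'. b \<in> W0 \<and> b' \<in> W0 \<and> (\<forall>W\<in>\<V>. b \<notin> W) \<and> (\<forall>a. b' + a *s b \<noteq> 0)"
proof -
  obtain B where B: "B \<subseteq> W0" "vec.independent B" "W0 \<subseteq> vec.span B" "card B = 2"
    using vec.basis_exists[of W0] W0(2) by metis
  then obtain w1 w2 where w: "B = {w1, w2}" "w1 \<noteq> w2" by (metis card_2_iff)
  have w1: "w1 \<notin> vec.span {w2}" and w2: "w2 \<notin> vec.span {w1}"
    using B(2) w by (auto simp: vec.independent_insert vec.dependent_def insert_commute insert_Diff_if split: if_splits)
  have uniq: "s = s'" if W: "W \<in> \<V>" "w1 + s *s w2 \<in> W" "w1 + s' *s w2 \<in> W" for W s s'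
  proof (rule ccontr)
    assume ne: "s \<noteq> s'"
    note sub = assms(2)[OF W(1)]
    have 2: "w2 \<in> W" using subspace_shift_unique[OF sub _ W(2,3)] ne by blast
    then have "(w1 + s *s w2) - s *s w2 \<in> W"
      using W(2) sub by (intro vec.subspace_diff vec.subspace_scale)
    then have "vec.span B \<subseteq> W" using 2 w sub by (intro vec.span_minimal) auto
    then have "W0 = W"
      using vec.subspace_dim_equal[OF W0(1) sub] B(3) W0(2) assms(3)[OF W(1)] by auto
    then show False using W(1) W0(3) by simp
  qed
  have "finite {s. w1 + s *s w2 \<in> W}" if "W \<in> \<V>" for W
  proof (cases "\<exists>s. w1 + s *s w2 \<in> W")
    case True
    then obtain s where "w1 + s *s w2 \<in> W" ..
    then have "{s. w1 + s *s w2 \<in> W} \<subseteq> {s}" using uniq[OF that] by blast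
    then show ?thesis by (rule finite_subset) simp
  qed simp
  then have "finite (\<Union>W\<in>\<V>. {s. w1 + s *s w2 \<in> W})" using assms(1) by blast
  then obtain s where s: "s \<notin> (\<Union>W\<in>\<V>. {s. w1 + s *s w2 \<in> W})"
    using infinite_UNIV_char_0 ex_new_if_finite by blast
  have "w2 + a *s (w1 + s *s w2) \<noteq> 0" for a
  proof
    assume eq: "w2 + a *s (w1 + s *s w2) = 0"
    show False
    proof (cases "a = 0")
      case True
      then show False using eq w2 by (simp add: vec.span_zero)
    next
      case False
      have "a *s w1 = (- (1 + a * s)) *s w2"
        using eq by (simp add: vec_eq_iff algebra_simps eq_neg_iff_add_eq_0)
      then have "inverse a *s (a *s w1) \<in> vec.span {w2}"
        by (simp add: vec.span_scale vec.span_base vec.span_neg)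
      then show False using False w1 by simp
    qed
  qed
  moreover have "w1 + s *s w2 \<in> W0" "w2 \<in> W0"
    using B(1) w W0(1) by (auto intro: vec.subspace_add vec.subspace_scale)
  ultimately show ?thesis using s by blast
qed

text \<open>In the chart where \<open>\<langle>e\<rangle>\<close> is the vertical direction, planes through \<open>e\<close> become vertical lines
  and the others graphs of affine functions; the chart keeps the plane at infinity out of \<open>\<V>\<close>,
  which makes the slopes distinct.\<close>

lemma affine_coordinates:
  fixes \<V> \<H> :: "('k::field_char_0 ^ 3) set set"
  assumes fin: "finite \<V>"
    and V: "\<And>W. W \<in> \<V> \<Longrightarrow> vec.subspace W \<and> vec.dim W = 2 \<and> e \<in> W"
    and H: "\<And>W. W \<in> \<H> \<Longrightarrow> vec.subspace W \<and> vec.dim W = 2 \<and> e \<notin> W"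
    and modular: "\<And>W1 W2. W1 \<in> \<H> \<Longrightarrow> W2 \<in> \<H> \<Longrightarrow> W1 \<noteq> W2 \<Longrightarrow> \<exists>W\<in>\<V>. W1 \<inter> W2 \<subseteq> W"
    and e: "e \<noteq> 0" and ne: "\<H> \<noteq> {}"
  shows "\<exists>(a :: _ \<Rightarrow> 'k) c d. inj_on a \<V> \<and> inj_on c \<H> \<and>
    (\<forall>W1\<in>\<H>. \<forall>W2\<in>\<H>. \<forall>W\<in>\<V>. W1 \<noteq> W2 \<longrightarrow>
      (W1 \<inter> W2 \<subseteq> W \<longleftrightarrow> c W1 * a W + d W1 = c W2 * a W + d W2))"
proof -
  obtain W0 where W0: "W0 \<in> \<H>" using ne by blast
  obtain b b' where b: "b \<in> W0" "b' \<in> W0" "\<And>W. W \<in> \<V> \<Longrightarrow> b \<notin> W" "\<And>a. b' + a *s b \<noteq> 0"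
    using vector_avoiding_planes[of \<V> W0] fin V H[OF W0] by blast
  \<comment> \<open>The point (t, y) of the chart is spanned by \<open>b' + t *s b + y *s e\<close>.
    So \<open>a\<close> is the abscissa of a vertical plane, and \<open>c\<close>, \<open>d\<close>
    are slope and intercept of the others; \<open>W0\<close> itself has slope and intercept
    0.\<close>
  obtain a where a: "\<And>W. W \<in> \<V> \<Longrightarrow> b' + a W *s b \<in> W"
    using plane_complement[of _ b b'] V b(3) by metis
  obtain c where c: "\<And>W. W \<in> \<H> \<Longrightarrow> b + c W *s e \<in> W"
    using plane_complement[of _ e b] H by metis
  obtain d where d: "\<And>W. W \<in> \<H> \<Longrightarrow> b' + d W *s e \<in> W"
    using plane_complement[of _ e b'] H by metis
  define x where "x = (\<lambda>t. b' + t *s b)"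
  have xW0: "x t \<in> W0" for t
    using H[OF W0] b(1,2) by (auto simp: x_def intro: vec.subspace_add vec.subspace_scale)
  have x_span: "x t \<noteq> k *s e" for t k
  proof
    assume eq: "x t = k *s e"
    then have "k \<noteq> 0" using b(4)[of t] by (auto simp: x_def)
    then have "e = inverse k *s x t" by (simp add: eq)
    then show False using xW0[of t] H[OF W0] vec.subspace_scale by metis
  qed
  have graph: "x t + (c W * t + d W) *s e \<in> W" if "W \<in> \<H>" for W t
  proof -
    have "(b' + d W *s e) + t *s (b + c W *s e) \<in> W"
      using vec.subspace_add[OF _ d[OF that] vec.subspace_scale[OF _ c[OF that]]] H[OF that] by blast
    moreover have "(b' + d W *s e) + t *s (b + c W *s e) = x t + (c W * t + d W) *s e"
      by (simp add: x_def vec_eq_iff algebra_simps)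
    ultimately show ?thesis by simp
  qed
  have "inj_on a \<V>"
  proof (rule inj_onI, rule ccontr)
    fix W W' assume W: "W \<in> \<V>" "W' \<in> \<V>" "a W = a W'" "W \<noteq> W'"
    have "vec.dim (W \<inter> W') = 1" using dim_plane_Int V W by blast
    then have "W \<inter> W' = vec.span {e}"
      using V[OF W(1)] V[OF W(2)] e by (intro span_eq_of_dim_1) (auto simp: vec.subspace_inter)
    moreover have "x (a W) \<in> W \<inter> W'" using a[OF W(1)] a[OF W(2)] W(3) by (simp add: x_def)
    ultimately show False using x_span[of "a W"] by (auto simp: vec.span_singleton)
  qed
  \<comment> \<open>Planes of equal slope share the vector \<open>b + c W1 *s e\<close> at infinity.
    By modularity a vertical plane contains it, and with \<open>e\<close> also \<open>b\<close>,
    against the choice of \<open>b\<close>.\<close>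
  moreover have "inj_on c \<H>"
  proof (rule inj_onI, rule ccontr)
    fix W1 W2 assume W: "W1 \<in> \<H>" "W2 \<in> \<H>" "c W1 = c W2" "W1 \<noteq> W2"
    then obtain W where W': "W \<in> \<V>" "W1 \<inter> W2 \<subseteq> W" using modular by blast
    then have "b + c W1 *s e \<in> W" using c[OF W(1)] c[OF W(2)] W(3) by auto
    then have "(b + c W1 *s e) - c W1 *s e \<in> W"
      using V[OF W'(1)] by (intro vec.subspace_diff vec.subspace_scale) auto
    then show False using b(3)[OF W'(1)] by simp
  qed
  moreover have "W1 \<inter> W2 \<subseteq> W \<longleftrightarrow> c W1 * a W + d W1 = c W2 * a W + d W2"
    if W: "W1 \<in> \<H>" "W2 \<in> \<H>" "W \<in> \<V>" "W1 \<noteq> W2" for W1 W2 W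
  proof -
    define l1 l2 where "l1 = c W1 * a W + d W1" and "l2 = c W2 * a W + d W2"
    \<comment> \<open>\<open>y\<close> spans the point where \<open>W1\<close> meets the vertical
      plane \<open>W\<close>; both directions come down to whether \<open>y\<close> lies in
      \<open>W2\<close>.\<close>
    define y where "y = x (a W) + l1 *s e"
    have y1: "y \<in> W1" using graph[OF W(1)] by (simp add: y_def l1_def)
    have y2: "x (a W) + l2 *s e \<in> W2" using graph[OF W(2)] by (simp add: l2_def)
    have yW: "y \<in> W"
      unfolding y_def using a[OF W(3)] V[OF W(3)]
      by (auto simp: x_def intro!: vec.subspace_add vec.subspace_scale)
    have y0: "y \<noteq> 0"
      using x_span[of "a W" "- l1"] by (auto simp: y_def eq_neg_iff_add_eq_0 vec.scale_minus_left)
    have dim12: "vec.dim (W1 \<inter> W2) = 1" using dim_plane_Int H W by blast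
    have sub12: "vec.subspace (W1 \<inter> W2)" using H W by (simp add: vec.subspace_inter)
    show ?thesis
    proof
      assume "W1 \<inter> W2 \<subseteq> W"
      then have "W1 \<inter> W2 \<subseteq> W1 \<inter> W" by blast
      moreover have "W1 \<noteq> W" using H[OF W(1)] V[OF W(3)] by blast
      then have "vec.dim (W1 \<inter> W) = 1" using dim_plane_Int H[OF W(1)] V[OF W(3)] by blast
      moreover have "vec.subspace (W1 \<inter> W)" using H[OF W(1)] V[OF W(3)] by (simp add: vec.subspace_inter)
      ultimately have "W1 \<inter> W2 = W1 \<inter> W"
        using vec.subspace_dim_equal[OF sub12] dim12 by simp
      then have "y \<in> W2" using y1 yW by blast
      then have "l1 = l2"
        using subspace_shift_unique[of W2 e "x (a W)" l1 l2] H[OF W(2)] y2 by (simp add: y_def)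
      then show "c W1 * a W + d W1 = c W2 * a W + d W2" by (simp add: l1_def l2_def)
    next
      assume "c W1 * a W + d W1 = c W2 * a W + d W2"
      then have "y \<in> W2" using y2 by (simp add: y_def l1_def l2_def)
      then have "W1 \<inter> W2 = vec.span {y}"
        using span_eq_of_dim_1[OF sub12 dim12] y1 y0 by blast
      then show "W1 \<inter> W2 \<subseteq> W" using yW V[OF W(3)] by (simp add: vec.span_minimal)
    qed
  qed
  ultimately show ?thesis
    by (intro exI[of _ a] exI[of _ c] exI[of _ d]) simp
qed

lemma supersolvableD:
  assumes "supersolvable_with_modular_point A p" "H \<in> A - lines_through A p"
    "L \<in> A - lines_through A p" "H \<noteq> L"
  shows "\<exists>!K. K \<in> lines_through A p \<and> H \<inter> L \<subseteq> K"
proof -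
  have "\<forall>H\<in>A - lines_through A p. \<forall>L\<in>A - lines_through A p.
      H \<noteq> L \<longrightarrow> (\<exists>!K. K \<in> lines_through A p \<and> H \<inter> L \<subseteq> K)"
    using assms(1) unfolding supersolvable_with_modular_point_def by (rule conjunct2)
  from this[rule_format, OF assms(2-4)] show ?thesis .
qed


lemma proj_lines_meet:
  assumes "H \<in> proj_lines" "L \<in> proj_lines" "H \<noteq> L"
  shows "\<exists>q\<in>proj_points. H \<inter> L = {q}"
proof -
  obtain W1 W2 where "vec.subspace W1" "vec.dim W1 = 2" "vec.subspace W2" "vec.dim W2 = 2"
    and HL: "H = proj_line_of W1" "L = proj_line_of W2"
    using assms(1,2) unfolding proj_lines_def by blast
  then show ?thesis
    using plane_Int_singleton[of W1 W2] assms(3) by metis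
qed

text \<open>Carries the chart over from planes to lines: \<open>P\<close> picks the plane behind a
  line, passing through \<open>p\<close> becomes containing \<open>e\<close>, and
  \<open>H \<inter> L \<subseteq> K\<close> becomes the same inclusion of planes.\<close>

lemma arrangement_coordinates:
  fixes A :: "('k::field_char_0 ^ 3) set set set"
  assumes arr: "line_arrangement A" and ss: "supersolvable_with_modular_point A p"
    and ne: "A - lines_through A p \<noteq> {}"
  shows "\<exists>(a :: _ \<Rightarrow> 'k) c d. inj_on a (lines_through A p) \<and> inj_on c (A - lines_through A p) \<and>
    (\<forall>H\<in>A - lines_through A p. \<forall>L\<in>A - lines_through A p. \<forall>K\<in>lines_through A p. H \<noteq> L \<longrightarrow>
      (H \<inter> L \<subseteq> K \<longleftrightarrow> c H * a K + d H = c L * a K + d L))"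
proof -
  define V where "V = lines_through A p"
  define B where "B = A - V"
  have "\<forall>H\<in>A. \<exists>W. vec.subspace W \<and> vec.dim W = 2 \<and> H = proj_line_of W"
    using arr by (auto simp: line_arrangement_def proj_lines_def)
  then obtain P where P: "\<And>H. H \<in> A \<Longrightarrow> vec.subspace (P H) \<and> vec.dim (P H) = 2 \<and> H = proj_line_of (P H)"
    by metis
  have VA: "V \<subseteq> A" "B \<subseteq> A" by (auto simp: V_def B_def lines_through_def)
  have injP: "inj_on P A" using P by (metis inj_onI)
  have p: "p \<in> proj_points" using ss by (simp add: supersolvable_with_modular_point_def)
  then have p_sub: "vec.subspace p" "vec.dim p = 1" by (auto simp: proj_points_def)
  obtain e where e: "e \<in> p" "e \<noteq> 0" using nonzero_of_dim_1[OF p_sub(2)] by blast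
  have p_e: "p = vec.span {e}" using span_eq_of_dim_1[OF p_sub e] .
  have through: "p \<in> H \<longleftrightarrow> e \<in> P H" if "H \<in> A" for H
  proof -
    have "p \<in> H \<longleftrightarrow> p \<subseteq> P H" using P[OF that] p unfolding proj_line_of_def by blast
    also have "\<dots> \<longleftrightarrow> e \<in> P H"
      using P[OF that] e(1) unfolding p_e by (meson empty_subsetI insert_subset subsetD vec.span_minimal)
    finally show ?thesis .
  qed
  have meet: "H \<inter> L \<subseteq> K \<longleftrightarrow> P H \<inter> P L \<subseteq> P K" if "H \<in> A" "L \<in> A" "K \<in> A" "H \<noteq> L" for H L K
  proof -
    have "P H \<noteq> P L" using injP that by (auto dest: inj_onD)
    then have "H \<inter> L = {P H \<inter> P L}" and pt: "P H \<inter> P L \<in> proj_points"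
      using plane_Int_singleton[of "P H" "P L"] P that by metis+
    then have "H \<inter> L \<subseteq> K \<longleftrightarrow> P H \<inter> P L \<in> proj_line_of (P K)"
      using P[OF that(3)] by simp
    also have "\<dots> \<longleftrightarrow> P H \<inter> P L \<subseteq> P K" using pt by (simp add: proj_line_of_def)
    finally show ?thesis .
  qed
  have "\<exists>(a :: _ \<Rightarrow> 'k) c d. inj_on a (P ` V) \<and> inj_on c (P ` B) \<and>
    (\<forall>W1\<in>P ` B. \<forall>W2\<in>P ` B. \<forall>W\<in>P ` V. W1 \<noteq> W2 \<longrightarrow>
      (W1 \<inter> W2 \<subseteq> W \<longleftrightarrow> c W1 * a W + d W1 = c W2 * a W + d W2))"
  proof (rule affine_coordinates)
    show "finite (P ` V)" using arr VA by (auto simp: line_arrangement_def intro: finite_subset)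
    show "vec.subspace W \<and> vec.dim W = 2 \<and> e \<in> W" if "W \<in> P ` V" for W
      using that P through by (auto simp: V_def lines_through_def)
    show "vec.subspace W \<and> vec.dim W = 2 \<and> e \<notin> W" if "W \<in> P ` B" for W
      using that P through by (auto simp: V_def B_def lines_through_def)
    show "\<exists>W\<in>P ` V. W1 \<inter> W2 \<subseteq> W" if W: "W1 \<in> P ` B" "W2 \<in> P ` B" "W1 \<noteq> W2" for W1 W2
    proof -
      obtain H L where HL: "H \<in> B" "L \<in> B" "W1 = P H" "W2 = P L" using W by blast
      then have "H \<noteq> L" using W(3) by blast
      then obtain K where "K \<in> V" "H \<inter> L \<subseteq> K"
        using ex1_implies_ex[OF supersolvableD[OF ss, of H L]] HL unfolding V_def B_def by blast
      then show ?thesis using meet[of H L K] HL VA \<open>H \<noteq> L\<close> by blast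
    qed
    show "e \<noteq> 0" by (rule e(2))
    show "P ` B \<noteq> {}" using ne by (simp add: B_def V_def)
  qed
  then obtain a :: "_ \<Rightarrow> 'k" and c d where acd: "inj_on a (P ` V)" "inj_on c (P ` B)"
    "\<And>W1 W2 W. W1 \<in> P ` B \<Longrightarrow> W2 \<in> P ` B \<Longrightarrow> W \<in> P ` V \<Longrightarrow> W1 \<noteq> W2 \<Longrightarrow>
      W1 \<inter> W2 \<subseteq> W \<longleftrightarrow> c W1 * a W + d W1 = c W2 * a W + d W2"
    by metis
  have "H \<inter> L \<subseteq> K \<longleftrightarrow> (c \<circ> P) H * (a \<circ> P) K + (d \<circ> P) H = (c \<circ> P) L * (a \<circ> P) K + (d \<circ> P) L"
    if "H \<in> B" "L \<in> B" "K \<in> V" "H \<noteq> L" for H L K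
  proof -
    have "P H \<noteq> P L" using injP that VA by (auto dest: inj_onD)
    then have "P H \<inter> P L \<subseteq> P K \<longleftrightarrow> c (P H) * a (P K) + d (P H) = c (P L) * a (P K) + d (P L)"
      using that by (intro acd(3)) auto
    moreover have "H \<inter> L \<subseteq> K \<longleftrightarrow> P H \<inter> P L \<subseteq> P K"
      using that VA by (intro meet) auto
    ultimately show ?thesis by simp
  qed
  moreover have "inj_on (a \<circ> P) V" "inj_on (c \<circ> P) B"
    using comp_inj_on[OF inj_on_subset[OF injP VA(1)] acd(1)]
      comp_inj_on[OF inj_on_subset[OF injP VA(2)] acd(2)] by auto
  ultimately show ?thesis
    unfolding V_def[symmetric] B_def[symmetric]
    by (intro exI[of _ "a \<circ> P"] exI[of _ "c \<circ> P"] exI[of _ "d \<circ> P"]) simp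
qed

section \<open>Counting double points\<close>

text \<open>In the chart, \<open>K\<close> is the vertical line over an abscissa where the form of
  \<open>H\<close> agrees with no other form. The point \<open>H \<inter> K\<close> will be a double
  point.\<close>

lemma free_vertical_line:
  fixes A :: "('k::field_char_0 ^ 3) set set set"
  assumes arr: "line_arrangement A" and ss: "supersolvable_with_modular_point A p"
    and m: "card (lines_through A p) \<ge> 2" and H: "H \<in> A - lines_through A p"
  shows "\<exists>K\<in>lines_through A p. \<forall>L\<in>A - lines_through A p - {H}. \<not> H \<inter> L \<subseteq> K"
proof -
  define V where "V = lines_through A p"
  define B where "B = A - V"
  have ne: "A - lines_through A p \<noteq> {}" using H by blast
  obtain a c d where acd: "inj_on a V" "inj_on c B"
    and iff: "\<forall>H\<in>B. \<forall>L\<in>B. \<forall>K\<in>V. H \<noteq> L \<longrightarrow>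
      (H \<inter> L \<subseteq> K \<longleftrightarrow> c H * a K + d H = c L * a K + (d L :: 'k))"
    using arrangement_coordinates[OF arr ss ne] unfolding V_def[symmetric] B_def[symmetric]
    by (elim exE conjE) (rule that)
  have "finite A" using arr by (simp add: line_arrangement_def)
  then have fin: "finite B" "finite (a ` V)" by (auto simp: B_def V_def lines_through_def)
  have "\<exists>t\<in>a ` V. \<forall>L\<in>B - {H}. c L * t + d L \<noteq> c H * t + d H"
  proof (rule affine_forms_separated[OF fin])
    show "card (a ` V) \<ge> 2" using m acd(1) by (simp add: card_image V_def)
    show "\<exists>t\<in>a ` V. c L * t + d L = c M * t + d M" if LM: "L \<in> B" "M \<in> B" "L \<noteq> M" for L M
    proof -
      obtain K where "K \<in> V" "L \<inter> M \<subseteq> K"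
        using ex1_implies_ex[OF supersolvableD[OF ss, of L M]] LM unfolding V_def B_def by blast
      then have "c L * a K + d L = c M * a K + d M" using iff LM by simp
      then show ?thesis using \<open>K \<in> V\<close> by blast
    qed
  qed (use H acd(2) in \<open>auto simp: B_def V_def\<close>)
  then obtain K where K: "K \<in> V" "\<And>L. L \<in> B - {H} \<Longrightarrow> c L * a K + d L \<noteq> c H * a K + d H"
    by blast
  have "\<not> H \<inter> L \<subseteq> K" if L: "L \<in> B - {H}" for L
    using K(2)[OF L] iff L K(1) H by (auto simp: B_def V_def)
  then show ?thesis using K(1) unfolding V_def B_def by blast
qed

text \<open>Ensures that \<open>n2\<close> is a true count and not the value 0 that
  \<open>card\<close> gives to infinite sets.\<close>

lemma finite_L2: "finite A \<Longrightarrow> finite (L2 A)"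
proof -
  assume "finite A"
  moreover have "L2 A \<subseteq> (\<lambda>(H, L). the_elem (H \<inter> L)) ` (A \<times> A)"
  proof
    fix q assume "q \<in> L2 A"
    then obtain H L where "H \<in> A" "L \<in> A" "H \<inter> L = {q}" unfolding L2_def by blast
    then show "q \<in> (\<lambda>(H, L). the_elem (H \<inter> L)) ` (A \<times> A)"
      by (intro image_eqI[of _ _ "(H, L)"]) simp_all
  qed
  ultimately show ?thesis by (meson finite_SigmaI finite_imageI finite_subset)
qed

theorem theorem3p7:
  fixes A :: "('k::field_char_0 ^ 3) set set set"
    and p :: "('k ^ 3) set"
    and m :: nat
  assumes "line_arrangement A"
    and "supersolvable_with_modular_point A p"
    and "mu A p \<ge> 1"
    and "m = mu A p + 1"
    and "card (A - lines_through A p) \<ge> 1"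
  shows "n2 A \<ge> max (card A - m) m"
proof -
  define V where "V = lines_through A p"
  define B where "B = A - V"
  define r where "r = card B"
  have fin: "finite A" and lines: "A \<subseteq> proj_lines"
    using assms(1) by (auto simp: line_arrangement_def)
  have V: "V = {H \<in> A. p \<in> H}" by (simp add: V_def lines_through_def)
  have finV: "finite V" "finite B" using fin by (auto simp: V B_def)
  \<comment> \<open>The subtraction in \<open>mu\<close> truncates at 0; since
    \<open>mu A p \<ge> 1\<close> it does not do so here.\<close>
  have mV: "m = card V" "m \<ge> 2" using assms(3,4) by (auto simp: mu_def V_def)
  have "V \<subseteq> A" by (auto simp: V)
  then have r: "card A - m = r" "r \<ge> 1"
    using assms(5) card_Diff_subset[OF finV(1), of A] by (simp_all add: r_def B_def V_def mV(1))
  have modular: "\<exists>!K. K \<in> V \<and> H \<inter> L \<subseteq> K" if "H \<in> B" "L \<in> B" "H \<noteq> L" for H L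
    using supersolvableD[OF assms(2)] that unfolding V_def B_def by simp

  \<comment> \<open>These are the lines through \<open>p\<close> that meet \<open>H\<close> in a
    double point.\<close>
  define G where "G = (\<lambda>H. {K \<in> V. \<forall>L\<in>B - {H}. \<not> H \<inter> L \<subseteq> K})"
  have finG: "finite (G H)" for H using finV by (simp add: G_def)
  have G1: "card (G H) \<ge> 1" if "H \<in> B" for H
  proof -
    have "G H \<noteq> {}"
      using free_vertical_line[OF assms(1,2), of H] that mV unfolding G_def V_def B_def by blast
    then show ?thesis using finG by (simp add: Suc_leI card_gt_0_iff)
  qed
  \<comment> \<open>By uniqueness in the modularity condition, each of the \<open>r - 1\<close>
    other lines off \<open>p\<close> excludes only one line through \<open>p\<close> from
    \<open>G H\<close>.\<close>
  have G2: "card (G H) + (r - 1) \<ge> m" if H: "H \<in> B" for H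
  proof -
    have "V - G H \<subseteq> (\<lambda>L. THE K. K \<in> V \<and> H \<inter> L \<subseteq> K) ` (B - {H})"
    proof
      fix K assume "K \<in> V - G H"
      then obtain L where L: "L \<in> B - {H}" "K \<in> V" "H \<inter> L \<subseteq> K" by (auto simp: G_def)
      then have "(THE K. K \<in> V \<and> H \<inter> L \<subseteq> K) = K"
        using modular[OF H, of L] by (intro the1_equality) auto
      then show "K \<in> (\<lambda>L. THE K. K \<in> V \<and> H \<inter> L \<subseteq> K) ` (B - {H})" using L(1) by force
    qed
    then have "card (V - G H) \<le> card (B - {H})" using finV by (intro surj_card_le) auto
    also have "\<dots> = r - 1" using H finV by (simp add: r_def)
    finally have "card (V - G H) \<le> r - 1" .
    moreover have "card (V - G H) = card V - card (G H)"
      using finG by (intro card_Diff_subset) (auto simp: G_def)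
    ultimately show ?thesis using mV by linarith
  qed

  have meet: "\<exists>q. H \<inter> L = {q}" if "H \<in> A" "L \<in> A" "H \<noteq> L" for H L
    using proj_lines_meet[of H L] that lines by blast
  have thr: "\<exists>q. H \<inter> K = {q} \<and> lines_through A q = {H, K}" if "H \<in> B" "K \<in> G H" for H K
  proof -
    have HK: "H \<in> A" "p \<notin> H" "K \<in> A" "p \<in> K" "H \<noteq> K" using that by (auto simp: B_def V G_def)
    obtain q where q: "H \<inter> K = {q}" using meet[OF HK(1,3,5)] by blast
    then have qHK: "q \<in> H" "q \<in> K" by auto
    \<comment> \<open>A third line through \<open>q\<close> that contains \<open>p\<close> would
      meet \<open>K\<close> in both \<open>p\<close> and \<open>q\<close>, putting \<open>p\<close>
      on \<open>H\<close>; one that avoids \<open>p\<close> is ruled out by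
      \<open>K \<in> G H\<close>.\<close>
    have "X = H \<or> X = K" if X: "X \<in> A" "q \<in> X" for X
    proof (rule ccontr)
      assume neq: "\<not> ?thesis"
      show False
      proof (cases "p \<in> X")
        case True
        obtain q' where q': "X \<inter> K = {q'}" using meet[OF X(1) HK(3)] neq by blast
        have "p \<in> X \<inter> K" "q \<in> X \<inter> K" using True HK(4) X(2) qHK by simp_all
        then have "p = q" unfolding q' by simp
        then show False using qHK(1) HK(2) by simp
      next
        case False
        obtain q' where q': "H \<inter> X = {q'}" using meet[OF HK(1) X(1)] neq by blast
        have "q \<in> H \<inter> X" using qHK(1) X(2) by simp
        then have "H \<inter> X \<subseteq> K" using qHK(2) unfolding q' by simp
        moreover have "X \<in> B - {H}" using X(1) False neq by (simp add: B_def V)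
        ultimately show False using \<open>K \<in> G H\<close> by (simp add: G_def)
      qed
    qed
    then have "lines_through A q = {H, K}" using qHK HK(1,3) unfolding lines_through_def by blast
    then show ?thesis using q by blast
  qed
  define \<phi> where "\<phi> = (\<lambda>(H, K). the_elem (H \<inter> K :: ('k ^ 3) set set))"
  have \<phi>: "H \<inter> K = {\<phi> (H, K)}" "lines_through A (\<phi> (H, K)) = {H, K}" if HK: "H \<in> B" "K \<in> G H" for H K
  proof -
    obtain q where "H \<inter> K = {q}" "lines_through A q = {H, K}" using thr[OF HK] by blast
    then show "H \<inter> K = {\<phi> (H, K)}" "lines_through A (\<phi> (H, K)) = {H, K}"
      by (simp_all add: \<phi>_def)
  qed
  have "\<phi> ` Sigma B G \<subseteq> double_points A"
  proof clarify
    fix H K assume HK: "H \<in> B" "K \<in> G H"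
    then have *: "H \<in> A" "K \<in> A" "H \<noteq> K" by (auto simp: B_def V G_def)
    then have "mu A (\<phi> (H, K)) = 1" using \<phi>(2)[OF HK] by (simp add: mu_def)
    moreover have "\<phi> (H, K) \<in> L2 A"
      unfolding L2_def mem_Collect_eq using * \<phi>(1)[OF HK] by (intro bexI[of _ H] bexI[of _ K] conjI)
    ultimately show "\<phi> (H, K) \<in> double_points A" by (simp add: double_points_def)
  qed
  \<comment> \<open>A double point determines its pair of lines, and only one line of the pair
    avoids \<open>p\<close>.\<close>
  moreover have "inj_on \<phi> (Sigma B G)"
  proof (rule inj_onI, clarify)
    fix H K H' K' assume HK: "H \<in> B" "K \<in> G H" "H' \<in> B" "K' \<in> G H'" "\<phi> (H, K) = \<phi> (H', K')"
    then have "{H, K} = {H', K'}" using \<phi>(2)[of H K] \<phi>(2)[of H' K'] by simp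
    moreover have "K \<notin> B" "K' \<notin> B" using HK by (auto simp: G_def B_def)
    ultimately show "H = H' \<and> K = K'" using HK by (auto simp: doubleton_eq_iff)
  qed
  moreover have "finite (double_points A)" using finite_L2[OF fin] by (simp add: double_points_def)
  ultimately have "card (Sigma B G) \<le> n2 A" unfolding n2_def by (metis card_inj_on_le)
  then have n2: "(\<Sum>H\<in>B. card (G H)) \<le> n2 A" using finV finG by simp

  have "r * 1 \<le> (\<Sum>H\<in>B. card (G H))"
    unfolding r_def using G1 by (intro sum_bounded_below[where 'a = nat, simplified]) auto
  then have n2_r: "r \<le> n2 A" using n2 by simp
  moreover have "m \<le> n2 A"
  proof (cases "r \<ge> m")
    \<comment> \<open>With \<open>m = r + t\<close>, \<open>G2\<close> gives at least
      \<open>t + 1\<close> double points on each line off \<open>p\<close>, and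
      \<open>r * (t + 1) \<ge> r + t\<close> because \<open>r \<ge> 1\<close>.\<close>
    case False
    then obtain t where t: "m = r + t" by (metis le_add_diff_inverse nat_le_linear)
    have "r * Suc t \<le> (\<Sum>H\<in>B. card (G H))"
      unfolding r_def using G2 t r(2) by (intro sum_bounded_below[where 'a = nat, simplified]) force
    moreover have "m \<le> r * Suc t" using r(2) t by simp
    ultimately show ?thesis using n2 by linarith
  qed (use n2_r in linarith)
  ultimately show ?thesis using r(1) by simp
qed

end
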